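(* If $0<c<c^*$, then there is no function $\phi\in C^2(\mathbb{R},\mathbb{R})$ with $0<\phi(\xi)\le\mathcal{K}$ for all $\xi\in\mathbb{R}$ satisfying $$\phi''(\xi)-c\,\phi'(\xi)-d\,\phi(\xi)+b\big(\phi(\xi-c\,\tau(\phi(\xi)))\big)=0,\qquad \xi\in\mathbb{R},$$ together with $$\lim_{\xi\to-\infty}\phi(\xi)=0,\qquad \liminf_{\xi\to+\infty}\phi(\xi)>0.$$
   Context: Setting. $d>0$ is a constant. The birth function $b:[0,\infty)\to[0,\infty)$ satisfies, for some constant $K>0$: $b(0)=0$, $b(K)=dK$, $b(u)>du$ for $u\in(0,K)$, and $0<b(u)<du$ for $u>K$. The delay function $\tau:[0,\infty)\to[0,\infty)$ is $C^1$ on $[0,\infty)$, satisfies $0\le\tau'(u)<1$ for all $u\ge 0$, and $0\le m:=\tau(0)\le\lim_{u\to\infty}\tau(u)=:M<\infty$. Further assumptions ($b$ need not be monotone): $b$ is $C^1$ on $[0,\infty)$; $b'(0)>d$ and $b(u)<b'(0)u$ for $u\in(0,\infty)$; $|b'(u)|\le b'(0)$ for $u\in[0,K]$; and there is $L>0$ such that $0\le b'(0)u-b(u)<Lu^2$ for $u\in(0,K]$. Notation: $\mathcal{K}=\frac1d\max_{u\in[0,K]}b(u)$. Definition of $c^*$. For $\lambda\ge0$, $c\ge0$ let $\Lambda(\lambda,c)=\lambda^2-c\lambda-d+b'(0)e^{-\lambda c m}$. Then $c^*>0$ is the constant such that $\Lambda(\lambda,c)>0$ for all $\lambda\ge0$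 if $c\in[0,c^* )$, while for $c>c^*$ the equation $\Lambda(\lambda,c)=0$ has exactly two distinct positive real roots $\lambda_1(c)<\lambda_2(c)$, with $\Lambda(\cdot,c)<0$ on $(\lambda_1(c),\lambda_2(c))$ and $\Lambda(\cdot,c)>0$ on $[0,\lambda_1(c))\cup(\lambda_2(c),\infty)$. *)

theory Defs
  imports "HOL-Analysis.Analysis"
begin

definition char_fun :: "real \<Rightarrow> real \<Rightarrow> real \<Rightarrow> real \<Rightarrow> real \<Rightarrow> real" where
  "char_fun d \<beta> m l c = l\<^sup>2 - c * l - d + \<beta> * exp (- l * c * m)"

definition is_critical_speed :: "real \<Rightarrow> real \<Rightarrow> real \<Rightarrow> real \<Rightarrow> bool" where
  "is_critical_speed d \<beta> m cs \<longleftrightarrow>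
     cs > 0 \<and>
     (\<forall>c\<in>{0..<cs}. \<forall>l\<ge>0. char_fun d \<beta> m l c > 0) \<and>
     (\<forall>c>cs. \<exists>l1 l2. 0 < l1 \<and> l1 < l2 \<and>
        {l. l > 0 \<and> char_fun d \<beta> m l c = 0} = {l1, l2} \<and>
        (\<forall>l\<in>{l1<..<l2}. char_fun d \<beta> m l c < 0) \<and>
        (\<forall>l\<in>{0..<l1} \<union> {l2<..}. char_fun d \<beta> m l c > 0))"

text \<open>The description below is proper whenever \<open>\<beta> > d > 0\<close> and \<open>m \<ge> 0\<close>;
  see \<open>ex1_critical_speed\<close>.\<close>

definition critical_speed :: "real \<Rightarrow> real \<Rightarrow> real \<Rightarrow> real" where
  "critical_speed d \<beta> m = (THE cs. is_critical_speed d \<beta> m cs)"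

lemma char_fun_strict_convex:
  assumes "\<beta> \<ge> 0" "x < y" "y < z"
  shows "(z - x) * char_fun d \<beta> m y c
           < (z - y) * char_fun d \<beta> m x c + (y - x) * char_fun d \<beta> m z c"
proof -
  define t where "t = (y - x) / (z - x)"
  have zx: "z - x > 0" using assms by simp
  have t: "0 \<le> t" "t \<le> 1" using assms zx by (auto simp: t_def divide_simps)
  have ty: "(z - x) * t = y - x" using zx by (simp add: t_def)
  have y: "y = (1 - t) * x + t * z" using ty by (simp add: algebra_simps)
  have t1: "(z - x) * (1 - t) = z - y" using ty by (simp add: algebra_simps)
  define E where "E = (\<lambda>u. exp (- u * c * m))"
  have "exp ((1 - t) *\<^sub>R (- x * c * m) + t *\<^sub>R (- z * c * m))
          \<le> (1 - t) * exp (- x * c * m) + t * exp (- z * c * m)"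
    by (rule convex_onD[OF exp_convex]) (use t in auto)
  moreover have "(1 - t) *\<^sub>R (- x * c * m) + t *\<^sub>R (- z * c * m) = - y * c * m"
    by (subst y) (simp add: algebra_simps)
  ultimately have "E y \<le> (1 - t) * E x + t * E z" unfolding E_def by simp
  then have "(z - x) * E y \<le> (z - x) * ((1 - t) * E x + t * E z)"
    using zx by (intro mult_left_mono) auto
  also have "\<dots> = ((z - x) * (1 - t)) * E x + ((z - x) * t) * E z"
    by (simp add: algebra_simps)
  also have "\<dots> = (z - y) * E x + (y - x) * E z"
    by (simp only: t1 ty)
  finally have "\<beta> * ((z - x) * E y) \<le> \<beta> * ((z - y) * E x + (y - x) * E z)"
    using assms(1) by (rule mult_left_mono)
  moreover have "(z - x) * (z - y) * (y - x) > 0" using assms by simp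
  then have "(z - x) * (y\<^sup>2 - c * y - d)
      < (z - y) * (x\<^sup>2 - c * x - d) + (y - x) * (z\<^sup>2 - c * z - d)"
    by (simp add: algebra_simps power2_eq_square)
  ultimately show ?thesis
    unfolding char_fun_def E_def
    by (simp add: algebra_simps)
qed

lemma critical_speed_two_roots:
  assumes "d > 0" "\<beta> > d" "c \<ge> 0" "l0 > 0" and neg: "char_fun d \<beta> m l0 c < 0"
  shows "\<exists>l1 l2. 0 < l1 \<and> l1 < l2 \<and>
        {l. l > 0 \<and> char_fun d \<beta> m l c = 0} = {l1, l2} \<and>
        (\<forall>l\<in>{l1<..<l2}. char_fun d \<beta> m l c < 0) \<and>
        (\<forall>l\<in>{0..<l1} \<union> {l2<..}. char_fun d \<beta> m l c > 0)"
proof -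
  define f where "f = (\<lambda>l. char_fun d \<beta> m l c)"
  have cont: "continuous_on S f" for S
    unfolding f_def char_fun_def by (intro continuous_intros)
  have cvx: "(z - x) * f y < (z - y) * f x + (y - x) * f z" if "x < y" "y < z" for x y z
    unfolding f_def using char_fun_strict_convex that assms by simp
  have f0: "f 0 > 0" using assms by (simp add: f_def char_fun_def)
  have fl0: "f l0 < 0" using neg by (simp add: f_def)
  define R where "R = l0 + c + d + 1"
  have "R * (R - c) \<ge> R * 1" using assms by (intro mult_left_mono) (auto simp: R_def)
  moreover have "R > d" using assms by (simp add: R_def)
  ultimately have "R\<^sup>2 - c * R - d > 0"
    by (simp add: power2_eq_square algebra_simps)
  moreover have "\<beta> * exp (- R * c * m) > 0" using assms by simp
  ultimately have fR: "f R > 0" unfolding f_def char_fun_def by linarith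
  obtain l1 where l1: "0 \<le> l1" "l1 \<le> l0" "f l1 = 0"
    using IVT2'[of f l0 0 0] f0 fl0 cont assms by auto
  obtain l2 where l2: "l0 \<le> l2" "l2 \<le> R" "f l2 = 0"
    using IVT'[of f l0 0 R] fR fl0 cont assms by (auto simp: R_def)
  have l: "0 < l1" "l1 < l0" "l0 < l2"
    using l1 l2 f0 fl0 by (auto simp: less_le)
  have inner: "f x < 0" if "l1 < x" "x < l2" for x
  proof -
    have "(l2 - l1) * f x < 0" using cvx[OF that] l1 l2 by simp
    then show ?thesis using that by (simp add: mult_less_0_iff)
  qed
  have left: "f x > 0" if "x < l1" for x
  proof -
    have "0 < (l2 - l1) * f x" using cvx[of x l1 l2] that l l1 l2 by simp
    then show ?thesis using l by (simp add: zero_less_mult_iff)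
  qed
  have right: "f x > 0" if "l2 < x" for x
  proof -
    have "0 < (l2 - l1) * f x" using cvx[of l1 l2 x] that l l1 l2 by simp
    then show ?thesis using l by (simp add: zero_less_mult_iff)
  qed
  have "x = l1 \<or> x = l2" if "f x = 0" for x
    using inner[of x] left[of x] right[of x] that by linarith
  then have "{x. x > 0 \<and> f x = 0} = {l1, l2}" using l l1 l2 by auto
  then show ?thesis
    using inner left right l unfolding f_def
    by (intro exI[of _ l1] exI[of _ l2]) auto
qed

lemma ex1_critical_speed:
  assumes d: "d > 0" and \<beta>: "\<beta> > d" and m: "m \<ge> 0"
  shows "\<exists>!cs. is_critical_speed d \<beta> m cs"
proof -
  define A where "A = {c. c \<ge> 0 \<and> (\<exists>l\<ge>0. char_fun d \<beta> m l c \<le> 0)}"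
  define B where "B = 1 + \<beta> * m"
  have B: "B > 0" using d \<beta> m by (simp add: B_def add_pos_nonneg)
  define \<delta> where "\<delta> = sqrt (\<beta> - d) / B"
  have \<delta>: "\<delta> > 0" using B \<beta> by (simp add: \<delta>_def)
  have lower: "\<delta> \<le> c" if cA: "c \<in> A" for c
  proof (rule ccontr)
    assume "\<not> \<delta> \<le> c"
    obtain l where l: "l \<ge> 0" "char_fun d \<beta> m l c \<le> 0" and c: "c \<ge> 0"
      using cA by (auto simp: A_def)
    have "c * B < sqrt (\<beta> - d)" using \<open>\<not> \<delta> \<le> c\<close> B by (simp add: \<delta>_def field_simps)
    then have sq: "(c * B)\<^sup>2 < \<beta> - d"
      using c B \<beta> by (metis abs_of_nonneg less_eq_real_def mult_nonneg_nonneg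
        real_less_rsqrt real_sqrt_abs real_sqrt_less_iff)
    have "1 + (- l * c * m) \<le> exp (- l * c * m)" by (rule exp_ge_add_one_self)
    then have "\<beta> * (1 + (- l * c * m)) \<le> \<beta> * exp (- l * c * m)"
      using d \<beta> by (intro mult_left_mono) auto
    then have "l\<^sup>2 - c * B * l + (\<beta> - d) \<le> 0"
      using l(2) by (simp add: char_fun_def B_def algebra_simps)
    moreover have "(l - c * B / 2)\<^sup>2 = l\<^sup>2 - c * B * l + (c * B)\<^sup>2 / 4"
      by (simp add: power2_eq_square field_simps)
    moreover have "(l - c * B / 2)\<^sup>2 \<ge> 0" "(c * B)\<^sup>2 \<ge> 0" by simp_all
    ultimately show False using sq by linarith
  qed
  have "char_fun d \<beta> m 1 (1 + \<beta>) \<le> 0"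
  proof -
    have "\<beta> * exp (- 1 * (1 + \<beta>) * m) \<le> \<beta> * 1"
      using d \<beta> m by (intro mult_left_mono) (auto intro: mult_nonpos_nonneg)
    then show ?thesis using d by (simp add: char_fun_def)
  qed
  then have "1 + \<beta> \<in> A" using d \<beta> by (auto simp: A_def intro!: exI[of _ 1])
  then have ne: "A \<noteq> {}" by blast
  have bdd: "bdd_below A" using lower by (rule bdd_belowI)
  have pos: "Inf A > 0" using cInf_greatest[OF ne lower] \<delta> by linarith
  have "is_critical_speed d \<beta> m (Inf A)"
    unfolding is_critical_speed_def
  proof (intro conjI ballI allI impI)
    fix c l :: real assume "c \<in> {0..<Inf A}" "l \<ge> 0"
    then show "char_fun d \<beta> m l c > 0"
      using cInf_lower[OF _ bdd, of c] by (force simp: A_def)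
  next
    fix c assume c: "Inf A < c"
    then obtain c0 where "c0 \<in> A" "c0 < c" using cInf_lessD[OF ne] by blast
    then obtain l0 where l0: "l0 \<ge> 0" "char_fun d \<beta> m l0 c0 \<le> 0" "c0 \<ge> 0"
      by (auto simp: A_def)
    have "l0 \<noteq> 0" using l0 \<beta> by (auto simp: char_fun_def)
    then have l0p: "l0 > 0" using l0 by simp
    have "l0 * m * c0 \<le> l0 * m * c"
      using l0p m \<open>c0 < c\<close> by (intro mult_left_mono) auto
    then have "exp (- l0 * c * m) \<le> exp (- l0 * c0 * m)"
      by (simp add: mult.commute mult.left_commute)
    then have "\<beta> * exp (- l0 * c * m) \<le> \<beta> * exp (- l0 * c0 * m)"
      using d \<beta> by (intro mult_left_mono) auto
    moreover have "c0 * l0 < c * l0" using \<open>c0 < c\<close> l0p by simp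
    ultimately have "char_fun d \<beta> m l0 c < 0" using l0(2) by (simp add: char_fun_def)
    then show "\<exists>l1 l2. 0 < l1 \<and> l1 < l2 \<and>
        {l. l > 0 \<and> char_fun d \<beta> m l c = 0} = {l1, l2} \<and>
        (\<forall>l\<in>{l1<..<l2}. char_fun d \<beta> m l c < 0) \<and>
        (\<forall>l\<in>{0..<l1} \<union> {l2<..}. char_fun d \<beta> m l c > 0)"
      using critical_speed_two_roots[OF d \<beta> _ l0p] c pos by simp
  qed (rule pos)
  moreover have False
    if x: "is_critical_speed d \<beta> m x" and y: "is_critical_speed d \<beta> m y" and "x < y" for x y
  proof -
    define c where "c = (x + y) / 2"
    have c: "x < c" "c < y" "0 \<le> c" using x \<open>x < y\<close> by (auto simp: c_def is_critical_speed_def)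
    obtain l1 l2 where "{l. l > 0 \<and> char_fun d \<beta> m l c = 0} = {l1, l2}"
      using x c(1) unfolding is_critical_speed_def by meson
    then have l: "l1 > 0" "char_fun d \<beta> m l1 c = 0" by blast+
    have "char_fun d \<beta> m l1 c > 0"
      using y c l(1) by (simp add: is_critical_speed_def)
    with l(2) show False by simp
  qed
  ultimately show ?thesis by (metis linorder_neqE_linordered_idom)
qed

text \<open>For continuous \<open>b\<close> and \<open>K \<ge> 0\<close> the supremum is the attained maximum over \<open>[0, K]\<close>.\<close>

definition profile_bound :: "real \<Rightarrow> (real \<Rightarrow> real) \<Rightarrow> real \<Rightarrow> real" where
  "profile_bound d b K = 1 / d * (SUP u\<in>{0..K}. b u)"

definition C2_real :: "(real \<Rightarrow> real) \<Rightarrow> bool" where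
  "C2_real \<phi> \<longleftrightarrow>
     (\<forall>x. \<phi> differentiable (at x)) \<and>
     (\<forall>x. deriv \<phi> differentiable (at x)) \<and>
     continuous_on UNIV (deriv (deriv \<phi>))"

end

theory Submission
  imports Defs
begin

text \<open>Consider the logarithmic derivative \<open>\<lambda> = \<phi>' / \<phi>\<close> and put \<open>S = limsup \<lambda>\<close> at \<open>-\<infinity>\<close>.
  Since \<open>b \<ge> 0\<close>, the profile satisfies \<open>\<phi>'' - c \<phi>' - d \<phi> \<le> 0\<close>, and a positive function with this
  property has bounded \<open>\<lambda>\<close>, so \<open>S < \<infinity>\<close>; as \<open>\<phi>\<close> is positive and tends to \<open>0\<close>, also \<open>S \<ge> 0\<close>.
  If \<open>\<lambda> \<le> s\<close> near \<open>-\<infinity>\<close>, the delayed term is at least about \<open>b'(0) exp (- s c m) \<phi>\<close>, so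
  \<open>\<lambda>' \<le> - \<Lambda>(S, c) + o(1)\<close> whenever \<open>\<lambda>\<close> is close to \<open>S\<close>. For \<open>c < c*\<close> the right-hand side is
  negative, hence following \<open>\<lambda>\<close> backwards from a value close to \<open>S\<close> it exceeds \<open>S\<close> by a fixed
  amount arbitrarily far to the left, which contradicts the choice of \<open>S\<close>.\<close>

section \<open>Comparison on left half-lines\<close>

text \<open>After the last point \<open>s\<close> where \<open>f\<close> is at most a level
  \<open>l\<close> between \<open>a\<close> and \<open>f X\<close>, the derivative is nonpositive,
  so the mean value theorem gives \<open>f X \<le> f s\<close>, which is absurd.\<close>

lemma DERIV_nonpos_above_imp_ge:
  fixes f f' :: "real \<Rightarrow> real"
  assumes der: "\<And>t. t \<le> X \<Longrightarrow> (f has_real_derivative f' t) (at t)"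
    and nonpos: "\<And>t. t \<le> X \<Longrightarrow> f t > a \<Longrightarrow> f' t \<le> 0"
    and "f X > a" "x \<le> X"
  shows "f x \<ge> f X"
proof (rule ccontr)
  assume "\<not> f x \<ge> f X"
  \<comment> \<open>At least \<open>a\<close>, to have the sign of \<open>f'\<close> above it; at
    least \<open>f x\<close>, to have \<open>x \<in> T\<close>; still below
    \<open>f X\<close>.\<close>
  define l where "l = max a (f x)"
  have l: "a \<le> l" "f x \<le> l" "l < f X" using assms \<open>\<not> f x \<ge> f X\<close> by (auto simp: l_def)
  define T where "T = {t \<in> {x..X}. f t \<le> l}"
  have "continuous_on {x..X} f"
    using der by (intro continuous_at_imp_continuous_on ballI) (metis DERIV_isCont atLeastAtMost_iff)
  then have "closed T" unfolding T_def
    by (intro continuous_on_closed_Collect_le) auto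
  moreover have "bounded T" by (rule bounded_subset[of "{x..X}"]) (auto simp: T_def)
  ultimately have "compact T" by (simp add: compact_eq_bounded_closed)
  moreover have "x \<in> T" using assms l by (simp add: T_def)
  ultimately obtain s where s: "s \<in> T" "\<And>t. t \<in> T \<Longrightarrow> t \<le> s"
    using compact_attains_sup[of T] by blast
  have sX: "s < X" using s(1) l by (auto simp: T_def less_le)
  obtain z where z: "s < z" "z < X" "f X - f s = (X - s) * f' z"
    using MVT2[OF sX, of f f'] der by auto
  have "z \<notin> T" using s(2)[of z] z by auto
  moreover have "x \<le> s" using s(1) by (simp add: T_def)
  ultimately have "f z > l" using z by (simp add: T_def)
  then have "f' z \<le> 0" using nonpos[of z] z l by simp
  then have "f X - f s \<le> 0" using z sX by (simp add: mult_nonneg_nonpos)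
  then show False using s l by (simp add: T_def)
qed

text \<open>Once above \<open>a\<close>, \<open>f\<close> stays there to the left and grows
  leftwards at rate at least \<open>\<eta>\<close>, so it would pass the bound \<open>B\<close>
  within finite distance.\<close>

lemma bounded_above_DERIV_le_neg_imp_le:
  fixes f f' :: "real \<Rightarrow> real"
  assumes der: "\<And>t. t \<le> X \<Longrightarrow> (f has_real_derivative f' t) (at t)"
    and neg: "\<And>t. t \<le> X \<Longrightarrow> f t > a \<Longrightarrow> f' t \<le> - \<eta>"
    and "\<eta> > 0" and bdd: "\<And>t. t \<le> X \<Longrightarrow> f t \<le> B" and "x \<le> X"
  shows "f x \<le> a"
proof (rule ccontr)
  assume "\<not> f x \<le> a"
  then have fx: "f x > a" by simp
  have above: "f t \<ge> f x" if "t \<le> x" for t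
  proof (rule DERIV_nonpos_above_imp_ge[where f = f and f' = f' and a = a, OF _ _ fx that])
    fix u assume "u \<le> x"
    then show "(f has_real_derivative f' u) (at u)" using der \<open>x \<le> X\<close> by simp
    show "f' u \<le> 0" if "f u > a" using neg[of u] that \<open>u \<le> x\<close> \<open>x \<le> X\<close> \<open>\<eta> > 0\<close> by simp
  qed
  have "f x \<le> B" using bdd assms by simp
  \<comment> \<open>Growth at rate \<open>\<eta>\<close> from \<open>x\<close> back to this point
    already forces \<open>f t \<ge> B + 1\<close>.\<close>
  define t where "t = x - (B - f x + 1) / \<eta>"
  have t: "t < x" using \<open>f x \<le> B\<close> \<open>\<eta> > 0\<close> by (simp add: t_def)
  obtain z where z: "t < z" "z < x" "f x - f t = (x - t) * f' z"
    using MVT2[OF t, of f f'] der assms by auto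
  have "f' z \<le> - \<eta>" using neg[of z] above[of z] fx z assms by simp
  then have "f x - f t \<le> (x - t) * (- \<eta>)" unfolding z(3) using t by (intro mult_left_mono) auto
  also have "\<dots> = - (B - f x + 1)" using \<open>\<eta> > 0\<close> by (simp add: t_def)
  finally have "f t \<ge> B + 1" by simp
  moreover have "f t \<le> B" using t \<open>x \<le> X\<close> by (intro bdd) simp
  ultimately show False by simp
qed

section \<open>A priori estimates for positive profiles\<close>

text \<open>If \<open>f = p' - \<mu> * p\<close> were positive at \<open>x\<close>, it would stay at
  least \<open>f x\<close> to the left; then \<open>p'\<close> is bounded below by a positive
  constant there and \<open>p\<close> reaches 0. The factor \<open>c + d + 1\<close> is a convenient
  \<open>\<mu> \<ge> c\<close> beyond the positive root of
  \<open>\<mu>\<^sup>2 - c * \<mu> - d\<close>.\<close>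

lemma pos_imp_DERIV_le_multiple:
  fixes p p' p'' :: "real \<Rightarrow> real"
  assumes der: "\<And>x. (p has_real_derivative p' x) (at x)"
    and der': "\<And>x. (p' has_real_derivative p'' x) (at x)"
    and pos: "\<And>x. p x > 0"
    and sub: "\<And>x. p'' x - c * p' x - d * p x \<le> 0"
    and "c > 0" "d > 0"
  shows "p' x \<le> (c + d + 1) * p x"
proof (rule ccontr)
  define \<mu> where "\<mu> = c + d + 1"
  define f where "f = (\<lambda>t. p' t - \<mu> * p t)"
  assume "\<not> p' x \<le> (c + d + 1) * p x"
  then have fx: "f x > 0" by (simp add: f_def \<mu>_def)
  have "c * \<mu> - \<mu>\<^sup>2 + d = - (c * d + d * d + c + d + 1)"
    by (simp add: \<mu>_def power2_eq_square algebra_simps)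
  moreover have "c * d > 0" "d * d > 0" using \<open>c > 0\<close> \<open>d > 0\<close> by simp_all
  ultimately have mu: "\<mu> > 0" "c * \<mu> - \<mu>\<^sup>2 + d \<le> 0"
    using \<open>c > 0\<close> \<open>d > 0\<close> unfolding \<mu>_def by linarith+
  have derf: "(f has_real_derivative p'' t - \<mu> * p' t) (at t)" for t
    unfolding f_def by (auto intro!: derivative_eq_intros der der')
  have neg: "p'' t - \<mu> * p' t \<le> 0" if "f t > 0" for t
  proof -
    \<comment> \<open>Substitute \<open>p' = f + \<mu> * p\<close> into the differential
      inequality.\<close>
    have "p'' t - \<mu> * p' t \<le> (c - \<mu>) * f t + (c * \<mu> - \<mu>\<^sup>2 + d) * p t"
      using sub[of t] by (simp add: f_def algebra_simps power2_eq_square)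
    moreover have "(c - \<mu>) * f t \<le> 0"
      using that assms by (intro mult_nonpos_nonneg) (auto simp: \<mu>_def)
    moreover have "(c * \<mu> - \<mu>\<^sup>2 + d) * p t \<le> 0"
      using mu pos[of t] by (intro mult_nonpos_nonneg) auto
    ultimately show ?thesis by linarith
  qed
  have above: "f t \<ge> f x" if "t \<le> x" for t
    by (rule DERIV_nonpos_above_imp_ge[OF derf neg fx that])
  \<comment> \<open>The zero of the line of slope \<open>f x\<close> through the point of the graph
    of \<open>p\<close> at \<open>x\<close>.\<close>
  define t where "t = x - p x / f x"
  have t: "t < x" using fx pos by (simp add: t_def)
  obtain z where z: "t < z" "z < x" "p x - p t = (x - t) * p' z"
    using MVT2[OF t, of p p'] der by auto
  have "\<mu> * p z > 0" using mu pos by simp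
  then have "p' z \<ge> f x" using above[of z] z unfolding f_def by simp
  then have "(x - t) * f x \<le> p x - p t" unfolding z(3) using t by (intro mult_left_mono) auto
  moreover have "(x - t) * f x = p x" using fx by (simp add: t_def)
  ultimately show False using pos[of t] by simp
qed

text \<open>Gronwall's argument: \<open>p t * exp (- s * (t - y))\<close> is nonincreasing in
  \<open>t\<close>. This bounds a delayed value from below by the current one.\<close>

lemma DERIV_le_multiple_imp_exp_le:
  fixes p p' :: "real \<Rightarrow> real"
  assumes der: "\<And>x. (p has_real_derivative p' x) (at x)"
    and le: "\<And>x. x \<le> X \<Longrightarrow> p' x \<le> s * p x" and "y \<le> x" "x \<le> X"
  shows "p x * exp (- s * (x - y)) \<le> p y"
proof -
  have "p x * exp (- s * (x - y)) \<le> p y * exp (- s * (y - y))"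
  proof (rule DERIV_nonpos_imp_nonincreasing[OF \<open>y \<le> x\<close>])
    fix t assume t: "y \<le> t" "t \<le> x"
    have "((\<lambda>t. p t * exp (- s * (t - y))) has_real_derivative
        (p' t - s * p t) * exp (- s * (t - y))) (at t)"
      by (auto intro!: derivative_eq_intros der simp: algebra_simps)
    moreover have "(p' t - s * p t) * exp (- s * (t - y)) \<le> 0"
      using le[of t] t assms by (intro mult_nonpos_nonneg) auto
    ultimately show "\<exists>D. ((\<lambda>t. p t * exp (- s * (t - y))) has_real_derivative D) (at t) \<and> D \<le> 0"
      by blast
  qed
  then show ?thesis by simp
qed

section \<open>Nonexistence below the critical speed\<close>

lemma char_fun_pos_below_critical_speed:
  assumes "d > 0" "\<beta> > d" "m \<ge> 0" "0 \<le> c" "c < critical_speed d \<beta> m" "l \<ge> 0"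
  shows "char_fun d \<beta> m l c > 0"
proof -
  have "is_critical_speed d \<beta> m (critical_speed d \<beta> m)"
    unfolding critical_speed_def using ex1_critical_speed[OF assms(1-3)] by (rule theI')
  then show ?thesis using assms by (simp add: is_critical_speed_def)
qed

text \<open>Here \<open>\<beta>\<close> and \<open>m\<close> stand for the slope of \<open>b\<close>
  and the value of \<open>\<tau>\<close> at 0. Besides nonnegativity, \<open>b\<close> and
  \<open>\<tau>\<close> enter only through their behaviour at \<open>0+\<close>.\<close>

lemma no_pos_profile_if_char_fun_pos:
  fixes p p' p'' b \<tau> :: "real \<Rightarrow> real"
  assumes der: "\<And>x. (p has_real_derivative p' x) (at x)"
    and der': "\<And>x. (p' has_real_derivative p'' x) (at x)"
    and pos: "\<And>x. p x > 0"
    and eq: "\<And>x. p'' x - c * p' x - d * p x + b (p (x - c * \<tau> (p x))) = 0"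
    and lim: "(p \<longlongrightarrow> 0) at_bot"
    and c: "c > 0" and d: "d > 0" and \<beta>: "\<beta> > 0"
    and b_nonneg: "\<And>u. u \<ge> 0 \<Longrightarrow> b u \<ge> 0"
    and b_near_0: "\<And>\<delta>. \<delta> > 0 \<Longrightarrow> \<forall>\<^sub>F u in at_right 0. b u \<ge> (\<beta> - \<delta>) * u"
    and \<tau>_nonneg: "\<And>u. u \<ge> 0 \<Longrightarrow> \<tau> u \<ge> 0"
    and \<tau>_near_0: "(\<tau> \<longlongrightarrow> m) (at_right 0)"
    and char_pos: "\<And>l. l \<ge> 0 \<Longrightarrow> char_fun d \<beta> m l c > 0"
  shows False
proof -
  define q where "q = (\<lambda>x. p' x / p x)"
  have p'_eq: "p' x = q x * p x" for x using pos[of x] by (simp add: q_def)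
  have derq: "(q has_real_derivative p'' x / p x - (q x)\<^sup>2) (at x)" for x
    unfolding q_def using pos[of x]
    by (auto intro!: derivative_eq_intros der der' simp: field_simps power2_eq_square)
  have "p'' x - c * p' x - d * p x \<le> 0" for x
    using eq[of x] b_nonneg[of "p (x - c * \<tau> (p x))"] pos[of "x - c * \<tau> (p x)"] by simp
  then have "p' x \<le> (c + d + 1) * p x" for x
    using pos_imp_DERIV_le_multiple[OF der der' pos] c d by blast
  then have q_bound: "q x \<le> c + d + 1" for x
    using pos[of x] by (simp add: q_def divide_le_eq)
  \<comment> \<open>The eventual upper bounds of \<open>q\<close> at minus infinity, so that
    \<open>Inf A\<close> is the real limsup \<open>S\<close> of the overview.\<close>
  define A where "A = {s. \<exists>X. \<forall>x\<le>X. q x \<le> s}"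
  have A_ne: "A \<noteq> {}" using q_bound by (auto simp: A_def)
  \<comment> \<open>A negative bound would make \<open>p\<close> nonincreasing near minus infinity,
    hence bounded away from its limit 0.\<close>
  have A_nonneg: "0 \<le> s" if "s \<in> A" for s
  proof (rule ccontr)
    assume "\<not> 0 \<le> s"
    obtain X where "\<And>x. x \<le> X \<Longrightarrow> q x \<le> s" using \<open>s \<in> A\<close> by (auto simp: A_def)
    with \<open>\<not> 0 \<le> s\<close> have X: "q x \<le> 0" if "x \<le> X" for x using that by fastforce
    have "p' x \<le> 0 * p x" if "x \<le> X" for x
      using X[OF that] pos[of x] by (simp add: p'_eq mult_nonpos_nonneg)
    then have ge: "p X \<le> p y" if "y \<le> X" for y
      using DERIV_le_multiple_imp_exp_le[OF der, of X 0 y X] that by simp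
    have "\<forall>\<^sub>F y in at_bot. p y < p X" using order_tendstoD(2)[OF lim pos] .
    then have "\<forall>\<^sub>F y in at_bot. p y < p X \<and> y \<le> X"
      using eventually_le_at_bot[of X] by (rule eventually_conj)
    then obtain y where "p y < p X" "y \<le> X"
      using eventually_happens'[OF trivial_limit_at_bot_linorder] by blast
    then show False using ge[of y] by simp
  qed
  have A_bdd: "bdd_below A" using A_nonneg by (rule bdd_belowI)
  define S where "S = Inf A"
  have S: "S \<ge> 0" unfolding S_def using A_ne A_nonneg by (rule cInf_greatest)
  \<comment> \<open>The characteristic function at \<open>S\<close> with all errors included:
    \<open>q\<close> within \<open>\<delta>\<close> of \<open>S\<close>, delay at most
    \<open>m + \<delta>\<close>, slope of \<open>b\<close> at least
    \<open>\<beta> - \<delta>\<close>. Its value at \<open>\<delta> = 0\<close> is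
    \<open>2 * \<eta>\<close>, which leaves room for a small positive
    \<open>\<delta>\<close>.\<close>
  define G where "G = (\<lambda>\<delta>. S\<^sup>2 - c * S - (2 * S + c) * \<delta> - d
    + (\<beta> - \<delta>) * exp (- (S + \<delta>) * (c * (m + \<delta>))))"
  define \<eta> where "\<eta> = char_fun d \<beta> m S c / 2"
  have \<eta>: "\<eta> > 0" using char_pos[OF S] by (simp add: \<eta>_def)
  have "(G \<longlongrightarrow> G 0) (at_right 0)" unfolding G_def by (intro tendsto_intros)
  moreover have "G 0 = 2 * \<eta>" by (simp add: G_def \<eta>_def char_fun_def algebra_simps)
  ultimately have "\<forall>\<^sub>F \<delta> in at_right 0. G \<delta> > \<eta>"
    using \<eta> by (intro order_tendstoD(1)) auto
  moreover have "\<forall>\<^sub>F \<delta> in at_right 0. \<delta> \<in> {0<..<\<beta>}"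
    using \<beta> by (rule eventually_at_right_real)
  ultimately have "\<forall>\<^sub>F \<delta> in at_right 0. G \<delta> > \<eta> \<and> 0 < \<delta> \<and> \<delta> < \<beta>"
    by eventually_elim auto
  then obtain \<delta> where \<delta>: "G \<delta> > \<eta>" "0 < \<delta>" "\<delta> < \<beta>"
    using eventually_happens'[of "at_right (0::real)"] by (auto simp: trivial_limit_at_right_real)
  have "Inf A < S + \<delta>" using \<delta> by (simp add: S_def)
  then obtain s where "s \<in> A" "s < S + \<delta>" using cInf_lessD[OF A_ne] by blast
  then obtain X1 where X1: "\<And>x. x \<le> X1 \<Longrightarrow> q x \<le> S + \<delta>" by (force simp: A_def)
  have lim': "filterlim p (at_right 0) at_bot"
    using lim pos by (auto simp: filterlim_at intro!: always_eventually less_imp_neq[THEN not_sym])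
  have "\<forall>\<^sub>F u in at_right 0. \<tau> u < m + \<delta>" using order_tendstoD(2)[OF \<tau>_near_0] \<delta> by simp
  then have "\<forall>\<^sub>F x in at_bot. \<tau> (p x) < m + \<delta>" by (rule eventually_compose_filterlim[OF _ lim'])
  moreover have "\<forall>\<^sub>F x in at_bot. b (p x) \<ge> (\<beta> - \<delta>) * p x"
    by (rule eventually_compose_filterlim[OF b_near_0[OF \<delta>(2)] lim'])
  ultimately have "\<forall>\<^sub>F x in at_bot. \<tau> (p x) < m + \<delta> \<and> b (p x) \<ge> (\<beta> - \<delta>) * p x"
    by (rule eventually_conj)
  then obtain X2 where X2: "\<And>x. x \<le> X2 \<Longrightarrow> \<tau> (p x) < m + \<delta>"
      "\<And>x. x \<le> X2 \<Longrightarrow> b (p x) \<ge> (\<beta> - \<delta>) * p x"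
    unfolding eventually_at_bot_linorder by blast
  define X where "X = min X1 X2"
  \<comment> \<open>The left side is \<open>q'\<close>, by the Riccati form of the equation; the
    matching upper bound \<open>q x \<le> S + \<delta>\<close> comes from \<open>X1\<close>.\<close>
  have step: "p'' x / p x - (q x)\<^sup>2 \<le> - \<eta>" if x: "x \<le> X" "q x > S - \<delta>" for x
  proof -
    define y where "y = x - c * \<tau> (p x)"
    define E where "E = exp (- (S + \<delta>) * (c * (m + \<delta>)))"
    have "c * \<tau> (p x) \<ge> 0" using c \<tau>_nonneg[of "p x"] pos[of x] by simp
    \<comment> \<open>The delay points to the left, so the estimates valid up to \<open>X\<close>
      also hold at \<open>y\<close>.\<close>
    then have y: "y \<le> x" by (simp add: y_def)
    have "p' t \<le> (S + \<delta>) * p t" if "t \<le> X1" for t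
      unfolding p'_eq using X1[OF that] pos[of t] by (intro mult_right_mono) auto
    then have py: "p x * exp (- (S + \<delta>) * (x - y)) \<le> p y"
      using y x by (intro DERIV_le_multiple_imp_exp_le[OF der]) (auto simp: X_def)
    have "\<tau> (p x) \<le> m + \<delta>" using X2(1)[of x] x by (simp add: X_def)
    then have "x - y \<le> c * (m + \<delta>)" using c by (simp add: y_def)
    then have "(S + \<delta>) * (x - y) \<le> (S + \<delta>) * (c * (m + \<delta>))"
      using S \<delta> by (intro mult_left_mono) auto
    then have "E \<le> exp (- (S + \<delta>) * (x - y))" by (simp only: E_def exp_le_cancel_iff mult_minus_left neg_le_iff_le)
    then have "p x * E \<le> p x * exp (- (S + \<delta>) * (x - y))"
      using pos[of x] by (intro mult_left_mono) auto
    with py have "p x * E \<le> p y" by linarith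
    then have "(\<beta> - \<delta>) * (p x * E) \<le> (\<beta> - \<delta>) * p y"
      using \<delta> by (intro mult_left_mono) auto
    also have "\<dots> \<le> b (p y)" using X2(2)[of y] x y by (simp add: X_def)
    finally have "p'' x \<le> (c * q x + d - (\<beta> - \<delta>) * E) * p x"
      using eq[of x] by (simp add: y_def p'_eq algebra_simps)
    then have "p'' x / p x \<le> c * q x + d - (\<beta> - \<delta>) * E"
      using pos[of x] by (simp add: divide_le_eq)
    \<comment> \<open>Expand around \<open>S\<close>, drop the square of \<open>q x - S\<close>, and
      use \<open>\<bar>2 * S - c\<bar> \<le> 2 * S + c\<close>.\<close>
    moreover have "(q x)\<^sup>2 - c * q x \<ge> S\<^sup>2 - c * S - (2 * S + c) * \<delta>"
    proof -
      have "\<bar>q x - S\<bar> \<le> \<delta>" using x X1[of x] by (simp add: X_def abs_le_iff)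
      then have "\<bar>2 * S - c\<bar> * \<bar>q x - S\<bar> \<le> (2 * S + c) * \<delta>"
        using S c by (intro mult_mono) auto
      then have "(2 * S - c) * (q x - S) \<ge> - ((2 * S + c) * \<delta>)"
        unfolding abs_mult[symmetric] by linarith
      moreover have "(q x)\<^sup>2 - c * q x = S\<^sup>2 - c * S + (2 * S - c) * (q x - S) + (q x - S)\<^sup>2"
        by (simp add: power2_eq_square algebra_simps)
      ultimately show ?thesis using zero_le_power2[of "q x - S"] by linarith
    qed
    ultimately show ?thesis using \<delta>(1) unfolding G_def E_def[symmetric] by linarith
  qed
  \<comment> \<open>The global bound on \<open>q\<close> excludes backward growth, so
    \<open>S - \<delta>\<close> is an eventual upper bound below the infimum
    \<open>S\<close>.\<close>
  have "q x \<le> S - \<delta>" if "x \<le> X" for x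
    by (rule bounded_above_DERIV_le_neg_imp_le[OF derq step \<eta> q_bound that])
  then have "S - \<delta> \<in> A" by (auto simp: A_def)
  then have "S \<le> S - \<delta>" unfolding S_def using A_bdd by (rule cInf_lower)
  then show False using \<delta> by simp
qed

theorem theorem3p1:
  fixes d K L M c :: real
    and b b' \<tau> \<tau>' :: "real \<Rightarrow> real"
  assumes d_pos: "d > 0" and K_pos: "K > 0"
    and b_nonneg: "\<And>u. u \<ge> 0 \<Longrightarrow> b u \<ge> 0"
    and b_0: "b 0 = 0" and b_K: "b K = d * K"
    and b_below: "\<And>u. 0 < u \<Longrightarrow> u < K \<Longrightarrow> b u > d * u"
    and b_above: "\<And>u. u > K \<Longrightarrow> 0 < b u \<and> b u < d * u"
    and tau_nonneg: "\<And>u. u \<ge> 0 \<Longrightarrow> \<tau> u \<ge> 0"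
    and tau_deriv: "\<And>u. u \<ge> 0 \<Longrightarrow> (\<tau> has_real_derivative \<tau>' u) (at u within {0..})"
    and tau'_cont: "continuous_on {0..} \<tau>'"
    and tau'_bounds: "\<And>u. u \<ge> 0 \<Longrightarrow> 0 \<le> \<tau>' u \<and> \<tau>' u < 1"
    and tau_lim: "(\<tau> \<longlongrightarrow> M) at_top"
    and tau_0: "0 \<le> \<tau> 0" "\<tau> 0 \<le> M"
    and b_deriv: "\<And>u. u \<ge> 0 \<Longrightarrow> (b has_real_derivative b' u) (at u within {0..})"
    and b'_cont: "continuous_on {0..} b'"
    and b'_0: "b' 0 > d"
    and b_sublinear: "\<And>u. u > 0 \<Longrightarrow> b u < b' 0 * u"
    and b'_bound: "\<And>u. 0 \<le> u \<Longrightarrow> u \<le> K \<Longrightarrow> \<bar>b' u\<bar> \<le> b' 0"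
    and L_pos: "L > 0"
    and b_quadratic: "\<And>u. 0 < u \<Longrightarrow> u \<le> K \<Longrightarrow> 0 \<le> b' 0 * u - b u \<and> b' 0 * u - b u < L * u\<^sup>2"
    and c_pos: "0 < c" and c_less: "c < critical_speed d (b' 0) (\<tau> 0)"
  shows "\<not> (\<exists>\<phi> :: real \<Rightarrow> real.
    C2_real \<phi> \<and>
    (\<forall>\<xi>. 0 < \<phi> \<xi> \<and> \<phi> \<xi> \<le> profile_bound d b K) \<and>
    (\<forall>\<xi>. deriv (deriv \<phi>) \<xi> - c * deriv \<phi> \<xi> - d * \<phi> \<xi>
           + b (\<phi> (\<xi> - c * \<tau> (\<phi> \<xi>))) = 0) \<and>
    (\<phi> \<longlongrightarrow> 0) at_bot \<and>
    Liminf at_top (\<lambda>\<xi>. ereal (\<phi> \<xi>)) > 0)"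
proof
  assume "\<exists>\<phi>. C2_real \<phi> \<and>
    (\<forall>\<xi>. 0 < \<phi> \<xi> \<and> \<phi> \<xi> \<le> profile_bound d b K) \<and>
    (\<forall>\<xi>. deriv (deriv \<phi>) \<xi> - c * deriv \<phi> \<xi> - d * \<phi> \<xi>
           + b (\<phi> (\<xi> - c * \<tau> (\<phi> \<xi>))) = 0) \<and>
    (\<phi> \<longlongrightarrow> 0) at_bot \<and>
    Liminf at_top (\<lambda>\<xi>. ereal (\<phi> \<xi>)) > 0"
  then obtain \<phi> where C2: "C2_real \<phi>" and pos: "\<And>\<xi>. 0 < \<phi> \<xi>"
    and eq: "\<And>\<xi>. deriv (deriv \<phi>) \<xi> - c * deriv \<phi> \<xi> - d * \<phi> \<xi>
           + b (\<phi> (\<xi> - c * \<tau> (\<phi> \<xi>))) = 0"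
    and lim: "(\<phi> \<longlongrightarrow> 0) at_bot" by blast
  have der: "(\<phi> has_real_derivative deriv \<phi> x) (at x)"
    and der': "(deriv \<phi> has_real_derivative deriv (deriv \<phi>) x) (at x)" for x
    using C2 by (auto simp: C2_real_def DERIV_deriv_iff_real_differentiable)
  have b_near_0: "\<forall>\<^sub>F u in at_right 0. b u \<ge> (b' 0 - \<delta>) * u" if "\<delta> > 0" for \<delta>
  proof -
    \<comment> \<open>Below \<open>K\<close> the quadratic estimate applies; below
      \<open>\<delta> / L\<close> its error \<open>L * u\<^sup>2\<close> is at most
      \<open>\<delta> * u\<close>.\<close>
    have "\<forall>\<^sub>F u in at_right 0. u \<in> {0<..<min K (\<delta> / L)}"
      using K_pos L_pos that by (intro eventually_at_right_real) auto
    then show ?thesis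
    proof eventually_elim
      case (elim u)
      then have "L * u \<le> \<delta>" using L_pos by (simp add: field_simps)
      then have "(L * u) * u \<le> \<delta> * u" using elim by (intro mult_right_mono) auto
      moreover have "b' 0 * u - b u < L * u * u"
        using b_quadratic[of u] elim by (simp add: power2_eq_square mult.assoc)
      ultimately have "b' 0 * u - b u \<le> \<delta> * u" by linarith
      then show ?case by (simp add: algebra_simps)
    qed
  qed
  have "(\<tau> \<longlongrightarrow> \<tau> 0) (at 0 within {0..})"
    using has_field_derivative_imp_has_derivative[OF tau_deriv[of 0]]
    by (auto dest!: has_derivative_continuous simp: continuous_within)
  then have \<tau>_near_0: "(\<tau> \<longlongrightarrow> \<tau> 0) (at_right 0)"
    by (rule tendsto_within_subset) auto
  have char_pos: "char_fun d (b' 0) (\<tau> 0) l c > 0" if "l \<ge> 0" for l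
    using char_fun_pos_below_critical_speed[OF d_pos b'_0 tau_0(1) _ c_less that] c_pos by simp
  have "b' 0 > 0" using d_pos b'_0 by simp
  then show False
    by (rule no_pos_profile_if_char_fun_pos[OF der der' pos eq lim c_pos d_pos _ b_nonneg
          b_near_0 tau_nonneg \<tau>_near_0 char_pos])
qed

end
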